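(* Let $\mathbf{r}$ be the Rudin-Shapiro sequence and $\mathbf{r}'=((-1)^n r(n))_{n\ge0}$. For every $n\ge 1$, $M_{\mathbf{r}}(n)=M_{\mathbf{r}'}(n)=:M(n)$. Moreover $M(1)=1$, $M(2)=2$, $M(3)=3$, and for all $n\ge 1$, \begin{align*} M(4n)&=2M(n)+2, & M(4n+1)&=2M(n)+1,\\ M(4n+2)&=M(n)+M(n+1)+1, & M(4n+3)&=2M(n+1)+1. \end{align*}
   Context: The Rudin-Shapiro sequence $\mathbf{r}=(r(n))_{n\ge 0}\in\{-1,1\}^{\mathbb{N}}$ is defined by $r(0)=1$, $r(2n)=r(n)$, $r(2n+1)=(-1)^n r(n)$ for $n\ge 0$. For an infinite word $\mathbf{w}=w(0)w(1)\cdots$ over a finite set of integers and $n\ge 1$, $M_{\mathbf{w}}(n):=\max_{i\ge 0}\sum_{j=i}^{i+n-1}w(j)$ is the maximal sum of $n$ consecutive letters. *)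

theory Defs
  imports Main
begin

fun rudin_shapiro :: "nat \<Rightarrow> int" where
  "rudin_shapiro n =
     (if n = 0 then 1
      else if even n then rudin_shapiro (n div 2)
      else (-1) ^ (n div 2) * rudin_shapiro (n div 2))"

declare rudin_shapiro.simps [simp del]

lemma rudin_shapiro_rec:
  shows "rudin_shapiro 0 = 1"
    and "rudin_shapiro (2 * n) = rudin_shapiro n"
    and "rudin_shapiro (2 * n + 1) = (-1) ^ n * rudin_shapiro n"
proof -
  show "rudin_shapiro 0 = 1"
    by (simp add: rudin_shapiro.simps)
  show "rudin_shapiro (2 * n) = rudin_shapiro n"
    by (cases "n = 0") (simp_all add: rudin_shapiro.simps [of "2 * n"])
  show "rudin_shapiro (2 * n + 1) = (-1) ^ n * rudin_shapiro n"
    by (subst rudin_shapiro.simps) simp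
qed

lemma rudin_shapiro_values: "rudin_shapiro n \<in> {-1, 1}"
proof (induction n rule: rudin_shapiro.induct)
  case (1 n)
  then show ?case
    by (cases "even (n div 2)") (auto simp: rudin_shapiro.simps [of n])
qed

definition rudin_shapiro_alt :: "nat \<Rightarrow> int" where
  "rudin_shapiro_alt n = (-1) ^ n * rudin_shapiro n"

lemma rudin_shapiro_alt_values: "rudin_shapiro_alt n \<in> {-1, 1}"
  using rudin_shapiro_values [of n]
  by (cases "even n") (auto simp: rudin_shapiro_alt_def)

definition window_sums :: "(nat \<Rightarrow> int) \<Rightarrow> nat \<Rightarrow> int set" where
  "window_sums w n = range (\<lambda>i. \<Sum>j = i..<i + n. w j)"

(* Max is only meaningful on finite nonempty sets; for words over a finite alphabet
   this is guaranteed by finite_window_sums and window_sums_nonempty. *)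
definition max_window_sum :: "(nat \<Rightarrow> int) \<Rightarrow> nat \<Rightarrow> int" where
  "max_window_sum w n = Max (window_sums w n)"

abbreviation M :: "nat \<Rightarrow> int" where
  "M \<equiv> max_window_sum rudin_shapiro"

lemma window_sums_nonempty: "window_sums w n \<noteq> {}"
  by (simp add: window_sums_def)

lemma finite_window_sums:
  assumes "finite (range w)"
  shows "finite (window_sums w n)"
proof (induction n)
  case 0
  show ?case by (simp add: window_sums_def)
next
  case (Suc n)
  have "window_sums w (Suc n) \<subseteq> (\<lambda>(a, b). a + b) ` (window_sums w n \<times> range w)"
    by (auto simp: window_sums_def image_iff)
  moreover have "finite ((\<lambda>(a, b). a + b) ` (window_sums w n \<times> range w))"
    using Suc assms by blast
  ultimately show ?case
    by (rule finite_subset)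
qed

lemma finite_range_rudin_shapiro:
  shows "finite (range rudin_shapiro)" and "finite (range rudin_shapiro_alt)"
  using rudin_shapiro_values rudin_shapiro_alt_values
  by (auto intro: finite_subset [of _ "{-1, 1}"])

end

theory Submission
  imports Defs
begin

text \<open>
  Write \<open>r\<close> for the Rudin-Shapiro word and \<open>r'\<close> for its alternating twist. That \<open>r\<close> and \<open>r'\<close>
  have the same maxima is a reflection symmetry: on a prefix of length \<open>2 ^ k\<close>, the word \<open>r'\<close> is,
  up to a sign depending on the parity of \<open>k\<close>, a later stretch of \<open>r\<close> read backwards, and vice
  versa. Choosing the parity that makes the sign positive, every window of one word occurs, reversed,
  in the other (\<open>window_sums_alt\<close>).

  The recurrences come from cutting \<open>r\<close> into blocks of length four, the \<open>m\<close>-th of which is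
  \<open>(r m, r m, r' m, - r' m)\<close> and thus has sum \<open>2 * r m\<close>. The sum of a window of length
  \<open>4 * n + t\<close> is therefore twice the sum of a window of length about \<open>n\<close> plus corrections at its
  two ends, and running through the four residues of the starting point gives the upper bounds.

  Attaining these bounds needs more than a maximal window of length \<open>n\<close>: the corrections at the ends
  are values of \<open>r'\<close> just before the window and at its last position, and they must have the right
  signs. So the proof carries along a stronger invariant (\<open>framed_maximum\<close>): the maximum is attained by
  a window for which these two values are \<open>-1\<close> and \<open>1\<close>. The optimal windows of lengths
  \<open>4 * n\<close>, \<open>4 * n + 1\<close> and \<open>4 * n + 3\<close> built from such windows are again of this kind. For
  \<open>4 * n + 2\<close> there are two cases: consecutive maxima differ by exactly one, for parity reasons, and
  the window is built from whichever of the lengths \<open>n\<close> and \<open>n + 1\<close> has the larger maximum, because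
  that maximality forces the additional sign that is needed.
  With explicit windows for lengths 1, 2 and 3, the invariant holds for every positive length, and the
  recurrences are its quantitative content.
\<close>

section \<open>Reflection: the two words have the same window sums\<close>

text \<open>
  Complementing all binary digits turns occurrences of \<open>11\<close> into occurrences of \<open>00\<close>, and the
  numbers of these differ, modulo two, by the last digit and a constant; the last digit is
  the twist \<open>(-1) ^ n\<close>. The bound on \<open>n\<close> fixes the leading digit of the \<open>Suc k\<close> digits to be zero.
\<close>
lemma rudin_shapiro_reflect:
  assumes "n < 2 ^ k"
  shows "rudin_shapiro (2 ^ Suc k - 1 - n) = (-1) ^ k * rudin_shapiro_alt n"
  using assms
proof (induction k arbitrary: n)
  case 0
  then show ?case
    using rudin_shapiro_rec(1) rudin_shapiro_rec(3)[of 0] by (simp add: rudin_shapiro_alt_def)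
next
  case (Suc k)
  define m where "m = n div 2"
  define q :: nat where "q = 2 ^ Suc k - 1 - m"
  have m: "m < 2 ^ k"
    using Suc.prems by (simp add: m_def)
  then have q: "q + m + 1 = 2 * 2 ^ k"
    by (simp add: q_def)
  have IH: "rudin_shapiro q = (-1) ^ k * ((-1) ^ m * rudin_shapiro m)"
    using Suc.IH[OF m] by (simp add: q_def rudin_shapiro_alt_def)
  have "even q \<longleftrightarrow> odd m"
    using arg_cong[OF q, of even] by auto
  then have sign: "(-1 :: int) ^ q = - ((-1) ^ m)"
    by (cases "even m") auto
  show ?case
  proof (cases "even n")
    case True
    then have n: "n = 2 * m"
      by (simp add: m_def)
    have "2 ^ Suc (Suc k) - 1 - n = 2 * q + 1"
      using q n by simp
    then show ?thesis
      using rudin_shapiro_rec(3)[of q] IH sign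
      by (cases "even m") (simp_all add: n rudin_shapiro_alt_def rudin_shapiro_rec(2))
  next
    case False
    then have n: "n = 2 * m + 1"
      by (simp add: m_def)
    have "2 ^ Suc (Suc k) - 1 - n = 2 * q"
      using q n by simp
    then show ?thesis
      using rudin_shapiro_rec(3)[of m] IH
      by (simp add: n rudin_shapiro_alt_def rudin_shapiro_rec(2))
  qed
qed

lemma rudin_shapiro_alt_reflect:
  assumes "n < 2 ^ k"
  shows "rudin_shapiro_alt (2 ^ Suc k - 1 - n) = - ((-1) ^ k * rudin_shapiro n)"
proof -
  define q :: nat where "q = 2 ^ Suc k - 1 - n"
  have q: "q + n + 1 = 2 * 2 ^ k"
    using assms by (simp add: q_def)
  have "even q \<longleftrightarrow> odd n"
    using arg_cong[OF q, of even] by auto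
  then show ?thesis
    using rudin_shapiro_reflect[OF assms] unfolding q_def[symmetric] rudin_shapiro_alt_def
    by (cases "even n") auto
qed

text \<open>
  Both words contain reversed copies of arbitrarily long prefixes of the other, and this
  is all that comparing window sums requires.
\<close>
lemma window_sums_subset_of_reflection:
  assumes "\<And>L. \<exists>N\<ge>L. \<forall>j<L. w j = v (N - j)"
  shows "window_sums w n \<subseteq> window_sums v n"
proof
  fix x
  assume "x \<in> window_sums w n"
  then obtain i where x: "x = (\<Sum>j = i..<i + n. w j)"
    by (auto simp: window_sums_def)
  obtain N where N: "N \<ge> i + n" and refl: "\<forall>j<i + n. w j = v (N - j)"
    using assms by blast
  have "x = (\<Sum>j = N + 1 - (i + n)..<N + 1 - (i + n) + n. v j)"
    unfolding x
    by (rule sum.reindex_bij_witness[where i = "\<lambda>j. N - j" and j = "\<lambda>j. N - j"])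
      (use N refl in auto)
  then show "x \<in> window_sums v n"
    by (auto simp: window_sums_def)
qed

lemma window_sums_alt: "window_sums rudin_shapiro_alt n = window_sums rudin_shapiro n"
proof
  \<comment> \<open>The sign in the reflection formula is positive for even exponents in one direction and for
    odd exponents in the other.\<close>
  have large: "L < 2 ^ (2 * L)" "L < 2 ^ Suc (2 * L)" for L :: nat
    using less_exp[of "2 * L"] less_exp[of "Suc (2 * L)"] by linarith+
  show "window_sums rudin_shapiro_alt n \<subseteq> window_sums rudin_shapiro n"
  proof (rule window_sums_subset_of_reflection)
    fix L :: nat
    show "\<exists>N\<ge>L. \<forall>j<L. rudin_shapiro_alt j = rudin_shapiro (N - j)"
      using rudin_shapiro_reflect[of _ "2 * L"] large(1)[of L]
      by (intro exI[of _ "2 ^ Suc (2 * L) - 1"]) auto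
  qed
  show "window_sums rudin_shapiro n \<subseteq> window_sums rudin_shapiro_alt n"
  proof (rule window_sums_subset_of_reflection)
    fix L :: nat
    show "\<exists>N\<ge>L. \<forall>j<L. rudin_shapiro j = rudin_shapiro_alt (N - j)"
      using rudin_shapiro_alt_reflect[of _ "Suc (2 * L)"] large(2)[of L]
      by (intro exI[of _ "2 ^ Suc (Suc (2 * L)) - 1"]) auto
  qed
qed

section \<open>Self-similarity of the partial sums\<close>

lemma rudin_shapiro_blocks:
  "rudin_shapiro (4 * m) = rudin_shapiro m"
  "rudin_shapiro (4 * m + 1) = rudin_shapiro m"
  "rudin_shapiro (4 * m + 2) = rudin_shapiro_alt m"
  "rudin_shapiro (4 * m + 3) = - rudin_shapiro_alt m"
proof -
  have "4 * m = 2 * (2 * m)" "4 * m + 1 = 2 * (2 * m) + 1"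
    "4 * m + 2 = 2 * (2 * m + 1)" "4 * m + 3 = 2 * (2 * m + 1) + 1"
    by simp_all
  then show
    "rudin_shapiro (4 * m) = rudin_shapiro m"
    "rudin_shapiro (4 * m + 1) = rudin_shapiro m"
    "rudin_shapiro (4 * m + 2) = rudin_shapiro_alt m"
    "rudin_shapiro (4 * m + 3) = - rudin_shapiro_alt m"
    by (simp_all only: rudin_shapiro_rec rudin_shapiro_alt_def) simp_all
qed

lemma rudin_shapiro_alt_blocks:
  "rudin_shapiro_alt (4 * m) = rudin_shapiro m"
  "rudin_shapiro_alt (4 * m + 1) = - rudin_shapiro m"
  "rudin_shapiro_alt (4 * m + 2) = rudin_shapiro_alt m"
  "rudin_shapiro_alt (4 * m + 3) = rudin_shapiro_alt m"
  unfolding rudin_shapiro_alt_def[of "4 * m"] rudin_shapiro_alt_def[of "4 * m + 1"]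
    rudin_shapiro_alt_def[of "4 * m + 2"] rudin_shapiro_alt_def[of "4 * m + 3"]
    rudin_shapiro_blocks
  by simp_all

definition partial_sum :: "nat \<Rightarrow> int" where
  "partial_sum k = (\<Sum>j<k. rudin_shapiro j)"

lemma partial_sum_Suc: "partial_sum (Suc k) = partial_sum k + rudin_shapiro k"
  by (simp add: partial_sum_def)

lemma window_sum_eq: "(\<Sum>j = i..<i + n. rudin_shapiro j) = partial_sum (i + n) - partial_sum i"
  by (induction n) (simp_all add: partial_sum_Suc)

text \<open>
  Since a block sums to \<open>2 * rudin_shapiro m\<close> and its first half already does so, partial sums at
  even positions are exact doubles; only odd positions contribute a correction.
\<close>
lemma partial_sum_blocks:
  "partial_sum (4 * m) = 2 * partial_sum m"
  "partial_sum (4 * m + 1) = 2 * partial_sum m + rudin_shapiro m"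
  "partial_sum (4 * m + 2) = 2 * partial_sum (m + 1)"
  "partial_sum (4 * m + 3) = 2 * partial_sum (m + 1) + rudin_shapiro_alt m"
proof -
  show start: "partial_sum (4 * m) = 2 * partial_sum m"
  proof (induction m)
    case 0
    show ?case by (simp add: partial_sum_def)
  next
    case (Suc m)
    have "4 * Suc m = Suc (4 * m + 3)" "4 * m + 3 = Suc (4 * m + 2)"
      "4 * m + 2 = Suc (4 * m + 1)" "4 * m + 1 = Suc (4 * m)"
      by simp_all
    then have "partial_sum (4 * Suc m) = partial_sum (4 * m) + rudin_shapiro (4 * m)
        + rudin_shapiro (4 * m + 1) + rudin_shapiro (4 * m + 2) + rudin_shapiro (4 * m + 3)"
      by (metis partial_sum_Suc)
    then show ?case
      unfolding rudin_shapiro_blocks using Suc by (simp add: partial_sum_Suc)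
  qed
  show one: "partial_sum (4 * m + 1) = 2 * partial_sum m + rudin_shapiro m"
    using partial_sum_Suc[of "4 * m"] start rudin_shapiro_blocks(1) by simp
  show two: "partial_sum (4 * m + 2) = 2 * partial_sum (m + 1)"
    using partial_sum_Suc[of "4 * m + 1"] one rudin_shapiro_blocks(2)[of m]
    by (simp add: partial_sum_Suc)
  show "partial_sum (4 * m + 3) = 2 * partial_sum (m + 1) + rudin_shapiro_alt m"
    using partial_sum_Suc[of "4 * m + 2"] two rudin_shapiro_blocks(3)[of m]
    by (simp add: numeral_3_eq_3)
qed

text \<open>This makes the maxima for consecutive lengths have different parity, hence differ.\<close>
lemma partial_sum_parity: "even (partial_sum k) \<longleftrightarrow> even k"
proof (induction k)
  case 0
  show ?case by (simp add: partial_sum_def)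
next
  case (Suc k)
  have "odd (rudin_shapiro k)"
    using rudin_shapiro_values[of k] by auto
  then show ?case
    using Suc by (simp add: partial_sum_Suc)
qed

section \<open>Maximal windows with prescribed boundary signs\<close>

text \<open>
  The maximal window starts at \<open>i + 1\<close>, so that \<open>i\<close> is the position just before it and \<open>i + n\<close> its last
  position. These are the positions at which a window four times as long picks up values of
  \<open>rudin_shapiro_alt\<close> when one of its ends falls between the third and fourth letter of a block.
\<close>
definition framed_maximum :: "nat \<Rightarrow> nat \<Rightarrow> int \<Rightarrow> bool" where
  "framed_maximum n i m \<longleftrightarrow>
     (\<forall>j. partial_sum (j + n) - partial_sum j \<le> m) \<and>
     partial_sum (i + 1 + n) - partial_sum (i + 1) = m \<and>
     rudin_shapiro_alt i = -1 \<and> rudin_shapiro_alt (i + n) = 1"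

text \<open>
  Naming the starting point \<open>s\<close> separately lets it be given in the form \<open>4 * k + t\<close>, to which the block
  formulas apply.
\<close>
lemma framed_maximumI:
  assumes "\<And>j. partial_sum (j + n) - partial_sum j \<le> m"
    and "s = i + 1" "partial_sum (s + n) - partial_sum s = m"
    and "rudin_shapiro_alt i = -1" "rudin_shapiro_alt (i + n) = 1"
  shows "framed_maximum n i m"
  using assms by (simp add: framed_maximum_def)

lemma framed_maximum_imp_M:
  assumes "framed_maximum n i m"
  shows "M n = m"
  unfolding max_window_sum_def
proof (rule Max_eqI)
  show "finite (window_sums rudin_shapiro n)"
    by (rule finite_window_sums[OF finite_range_rudin_shapiro(1)])
  show "y \<le> m" if "y \<in> window_sums rudin_shapiro n" for y
    using that assms by (auto simp: window_sums_def window_sum_eq framed_maximum_def)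
  have "m = (\<Sum>j = i + 1..<i + 1 + n. rudin_shapiro j)"
    using assms unfolding window_sum_eq framed_maximum_def by simp
  then show "m \<in> window_sums rudin_shapiro n"
    unfolding window_sums_def by blast
qed

lemma all_nat_mod4I:
  assumes "\<And>i. P (4 * i)" "\<And>i. P (4 * i + 1)" "\<And>i. P (4 * i + 2)" "\<And>i. P (4 * i + 3)"
  shows "P (j :: nat)"
proof -
  have "j mod 4 < 4"
    by simp
  then have "j mod 4 = 0 \<or> j mod 4 = 1 \<or> j mod 4 = 2 \<or> j mod 4 = 3"
    by linarith
  moreover have "j = 4 * (j div 4) + j mod 4"
    by simp
  ultimately show ?thesis
    using assms[of "j div 4"] by (metis add_0_right)
qed

lemma add_eq_Suc_iterate:
  "3 + k = Suc (Suc (Suc k))" "4 + k = Suc (Suc (Suc (Suc k)))"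
  by simp_all

lemma sign_bounds:
  "-1 \<le> rudin_shapiro k" "rudin_shapiro k \<le> 1"
  "-1 \<le> rudin_shapiro_alt k" "rudin_shapiro_alt k \<le> 1"
  using rudin_shapiro_values[of k] rudin_shapiro_alt_values[of k] by auto

text \<open>
  Starting one letter before a block boundary turns the two boundary values into a gain of
  \<open>- rudin_shapiro_alt i + rudin_shapiro_alt (i + n) = 2\<close> over the doubled sum. At the third position
  of a block the twisted word repeats its value at the block index, so the new frame inherits the old
  signs.
\<close>
lemma framed_maximum_4n:
  assumes "framed_maximum n i m"
  shows "framed_maximum (4 * n) (4 * i + 2) (2 * m + 2)"
proof -
  have bound: "partial_sum (j + n) - partial_sum j \<le> m" for j
    using assms by (simp add: framed_maximum_def)
  have "partial_sum (j + 4 * n) - partial_sum j \<le> 2 * m + 2" for j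
  proof (induction j rule: all_nat_mod4I)
    case (1 j)
    show ?case
      using bound[of j] partial_sum_blocks(1)[of j] partial_sum_blocks(1)[of "j + n"]
      by (simp add: algebra_simps add_eq_Suc_iterate)
  next
    case (2 j)
    show ?case
      using bound[of j] partial_sum_blocks(2)[of j] partial_sum_blocks(2)[of "j + n"]
        sign_bounds[of j] sign_bounds[of "j + n"]
      by (simp add: algebra_simps add_eq_Suc_iterate)
  next
    case (3 j)
    show ?case
      using bound[of "j + 1"] partial_sum_blocks(3)[of j] partial_sum_blocks(3)[of "j + n"]
      by (simp add: algebra_simps add_eq_Suc_iterate)
  next
    case (4 j)
    show ?case
      using bound[of "j + 1"] partial_sum_blocks(4)[of j] partial_sum_blocks(4)[of "j + n"]
        sign_bounds[of j] sign_bounds[of "j + n"]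
      by (simp add: algebra_simps add_eq_Suc_iterate)
  qed
  then show ?thesis
    by (rule framed_maximumI[where s = "4 * i + 3"])
      (use assms partial_sum_blocks(4)[of i] partial_sum_blocks(4)[of "i + n"]
      rudin_shapiro_alt_blocks(3)[of i] rudin_shapiro_alt_blocks(3)[of "i + n"] in
      \<open>simp_all add: framed_maximum_def algebra_simps add_eq_Suc_iterate\<close>)
qed

text \<open>
  The window again starts one letter before a block boundary but now ends at the end of a block, so
  only the left boundary value contributes. The bound for starting points \<open>4 * j + 1\<close> is the delicate one:
  there the window sum is that of the windows of length \<open>n\<close> starting at \<open>j\<close> and \<open>j + 1\<close>, plus
  the sign at \<open>j + n\<close>.
\<close>
lemma framed_maximum_4n_plus_1:
  assumes "framed_maximum n i m"
  shows "framed_maximum (4 * n + 1) (4 * i + 2) (2 * m + 1)"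
proof -
  have bound: "partial_sum (j + n) - partial_sum j \<le> m" for j
    using assms by (simp add: framed_maximum_def)
  have "partial_sum (j + (4 * n + 1)) - partial_sum j \<le> 2 * m + 1" for j
  proof (induction j rule: all_nat_mod4I)
    case (1 j)
    show ?case
      using bound[of j] partial_sum_blocks(1)[of j] partial_sum_blocks(2)[of "j + n"]
        sign_bounds[of "j + n"]
      by (simp add: algebra_simps add_eq_Suc_iterate)
  next
    case (2 j)
    show ?case
      using bound[of j] bound[of "j + 1"] partial_sum_blocks(2)[of j]
        partial_sum_blocks(3)[of "j + n"] sign_bounds[of "j + n"]
        partial_sum_Suc[of j] partial_sum_Suc[of "j + n"]
      by (simp add: algebra_simps add_eq_Suc_iterate)
  next
    case (3 j)
    show ?case
      using bound[of "j + 1"] partial_sum_blocks(3)[of j] partial_sum_blocks(4)[of "j + n"]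
        sign_bounds[of "j + n"]
      by (simp add: algebra_simps add_eq_Suc_iterate)
  next
    case (4 j)
    show ?case
      using bound[of "j + 1"] partial_sum_blocks(4)[of j] partial_sum_blocks(1)[of "j + n + 1"]
        sign_bounds[of j]
      by (simp add: algebra_simps add_eq_Suc_iterate)
  qed
  then show ?thesis
    by (rule framed_maximumI[where s = "4 * i + 3"])
      (use assms partial_sum_blocks(4)[of i] partial_sum_blocks(1)[of "i + n + 1"]
      rudin_shapiro_alt_blocks(3)[of i] rudin_shapiro_alt_blocks(4)[of "i + n"] in
      \<open>simp_all add: framed_maximum_def algebra_simps add_eq_Suc_iterate\<close>)
qed

text \<open>
  Here the window consists of \<open>n + 1\<close> whole blocks without the very last letter, which is
  \<open>- rudin_shapiro_alt (i + n + 1) = -1\<close>; dropping it gains one.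
\<close>
lemma framed_maximum_4n_plus_3:
  assumes "framed_maximum (n + 1) i m"
  shows "framed_maximum (4 * n + 3) (4 * i + 3) (2 * m + 1)"
proof -
  have bound: "partial_sum (j + n + 1) - partial_sum j \<le> m" for j
    using assms by (simp add: framed_maximum_def)
  have "partial_sum (j + (4 * n + 3)) - partial_sum j \<le> 2 * m + 1" for j
  proof (induction j rule: all_nat_mod4I)
    case (1 j)
    show ?case
      using bound[of j] partial_sum_blocks(1)[of j] partial_sum_blocks(4)[of "j + n"]
        sign_bounds[of "j + n"]
      by (simp add: algebra_simps add_eq_Suc_iterate)
  next
    case (2 j)
    show ?case
      using bound[of j] partial_sum_blocks(2)[of j] partial_sum_blocks(1)[of "j + n + 1"]
        sign_bounds[of j]
      by (simp add: algebra_simps add_eq_Suc_iterate)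
  next
    case (3 j)
    show ?case
      using bound[of "j + 1"] partial_sum_blocks(3)[of j] partial_sum_blocks(2)[of "j + n + 1"]
        sign_bounds[of "j + n + 1"] partial_sum_Suc[of "j + n + 1"]
      by (simp add: algebra_simps add_eq_Suc_iterate)
  next
    case (4 j)
    show ?case
      using bound[of "j + 1"] partial_sum_blocks(4)[of j] partial_sum_blocks(3)[of "j + n + 1"]
        sign_bounds[of j]
      by (simp add: algebra_simps add_eq_Suc_iterate)
  qed
  then show ?thesis
    by (rule framed_maximumI[where s = "4 * i + 4"])
      (use assms partial_sum_blocks(1)[of "i + 1"] partial_sum_blocks(4)[of "i + n + 1"]
      rudin_shapiro_alt_blocks(4)[of i] rudin_shapiro_alt_blocks(3)[of "i + n + 1"] in
      \<open>simp_all add: framed_maximum_def algebra_simps add_eq_Suc_iterate\<close>)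
qed

lemma framed_maximum_consecutive:
  assumes "framed_maximum n i m" "framed_maximum (n + 1) k m'"
  shows "m' = m + 1 \<or> m = m' + 1"
proof -
  have "partial_sum (k + 1 + n) - partial_sum (k + 1) \<le> m"
    "partial_sum (k + 1 + (n + 1)) - partial_sum (k + 1) = m'"
    "partial_sum (i + 1 + (n + 1)) - partial_sum (i + 1) \<le> m'"
    "partial_sum (i + 1 + n) - partial_sum (i + 1) = m"
    using assms unfolding framed_maximum_def by blast+
  moreover from this have "even m \<longleftrightarrow> even n" "even m' \<longleftrightarrow> even (n + 1)"
    by (auto simp: partial_sum_parity)
  then have "m \<noteq> m'"
    by auto
  ultimately show ?thesis
    using partial_sum_Suc[of "k + 1 + n"] partial_sum_Suc[of "i + 1 + n"]
      sign_bounds[of "k + 1 + n"] sign_bounds[of "i + 1 + n"]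
    by (simp, arith)
qed

text \<open>
  For windows made of halves of blocks the sum is \<open>2 * m\<close> or \<open>2 * m'\<close> at best, and this stays
  within \<open>m + m' + 1\<close> because the two maxima differ by one. Those windows have the wrong frame, so the
  witnesses start at odd positions instead.
\<close>
lemma framed_maximum_4n_plus_2:
  assumes short: "framed_maximum n i m" and long: "framed_maximum (n + 1) k m'"
  shows "\<exists>l. framed_maximum (4 * n + 2) l (m + m' + 1)"
proof -
  have bound: "partial_sum (j + n) - partial_sum j \<le> m" for j
    using short by (simp add: framed_maximum_def)
  have bound': "partial_sum (j + n + 1) - partial_sum j \<le> m'" for j
    using long by (simp add: framed_maximum_def)
  note consecutive = framed_maximum_consecutive[OF assms]
  have upper: "partial_sum (j + (4 * n + 2)) - partial_sum j \<le> m + m' + 1" for j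
  proof (induction j rule: all_nat_mod4I)
    case (1 j)
    show ?case
      using bound'[of j] partial_sum_blocks(1)[of j] partial_sum_blocks(3)[of "j + n"] consecutive
      by (auto simp: algebra_simps add_eq_Suc_iterate)
  next
    case (2 j)
    show ?case
      using bound[of "j + 1"] bound'[of j] partial_sum_blocks(2)[of j]
        partial_sum_blocks(4)[of "j + n"] sign_bounds[of "j + n"] partial_sum_Suc[of j]
      by (simp add: algebra_simps add_eq_Suc_iterate)
  next
    case (3 j)
    show ?case
      using bound[of "j + 1"] partial_sum_blocks(3)[of j] partial_sum_blocks(1)[of "j + n + 1"]
        consecutive
      by (auto simp: algebra_simps add_eq_Suc_iterate)
  next
    case (4 j)
    show ?case
      using bound[of "j + 1"] bound'[of "j + 1"] partial_sum_blocks(4)[of j]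
        partial_sum_blocks(2)[of "j + n + 1"] sign_bounds[of j] partial_sum_Suc[of "j + n + 1"]
      by (simp add: algebra_simps add_eq_Suc_iterate)
  qed
  from consecutive show ?thesis
  proof
    assume m': "m' = m + 1"
    \<comment> \<open>Otherwise dropping the last letter of the maximal window would leave a window of length \<open>n\<close> with sum above \<open>m\<close>.\<close>
    have last: "rudin_shapiro (k + n + 1) = 1"
      using bound[of "k + 1"] long partial_sum_Suc[of "k + n + 1"] sign_bounds[of "k + n + 1"] m'
      by (simp add: framed_maximum_def)
    have "framed_maximum (4 * n + 2) (4 * k + 2) (m + m' + 1)"
      by (rule framed_maximumI[OF upper, where s = "4 * k + 3"])
        (use long m' last partial_sum_blocks(4)[of k] partial_sum_blocks(2)[of "k + n + 1"]
        rudin_shapiro_alt_blocks(3)[of k] rudin_shapiro_alt_blocks(1)[of "k + n + 1"]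
        partial_sum_Suc[of "k + n + 1"] in
        \<open>simp_all add: framed_maximum_def algebra_simps add_eq_Suc_iterate\<close>)
    then show ?thesis ..
  next
    assume m: "m = m' + 1"
    \<comment> \<open>Otherwise prepending this letter would give a window of length \<open>n + 1\<close> with sum above \<open>m'\<close>.\<close>
    have before: "rudin_shapiro i = -1"
      using bound'[of i] short partial_sum_Suc[of i] sign_bounds[of i] m
      by (simp add: framed_maximum_def)
    have "framed_maximum (4 * n + 2) (4 * i) (m + m' + 1)"
      by (rule framed_maximumI[OF upper, where s = "4 * i + 1"])
        (use short m before partial_sum_blocks(2)[of i] partial_sum_blocks(4)[of "i + n"]
        rudin_shapiro_alt_blocks(1)[of i] rudin_shapiro_alt_blocks(3)[of "i + n"]
        partial_sum_Suc[of i] in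
        \<open>simp_all add: framed_maximum_def algebra_simps add_eq_Suc_iterate\<close>)
    then show ?thesis ..
  qed
qed

text \<open>
  The letters at positions 7 to 10 are all \<open>1\<close>, the first such run of length four; it hosts the windows
  of lengths two and three.
\<close>
lemma framed_maximum_small:
  "framed_maximum 1 1 1" "framed_maximum 2 6 2" "framed_maximum 3 7 3"
proof -
  have upper: "partial_sum (j + n) - partial_sum j \<le> int n" for j n
    using sum_bounded_above[of "{j..<j + n}" rudin_shapiro 1] sign_bounds
    by (simp add: window_sum_eq)
  have "rudin_shapiro 0 = 1" "rudin_shapiro 1 = 1" "rudin_shapiro 2 = 1"
    "rudin_shapiro 6 = -1" "rudin_shapiro 7 = 1" "rudin_shapiro 8 = 1"
    "rudin_shapiro 9 = 1" "rudin_shapiro 10 = 1"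
    by (simp_all add: rudin_shapiro.simps)
  note vals = this partial_sum_Suc[of 2] partial_sum_Suc[of 7] partial_sum_Suc[of 8]
    partial_sum_Suc[of 9] partial_sum_Suc[of 10] rudin_shapiro_alt_def
  show "framed_maximum 1 1 1"
    by (rule framed_maximumI[where s = 2]) (use upper[of _ 1] vals in \<open>simp_all add: numeral_2_eq_2\<close>)
  show "framed_maximum 2 6 2"
    by (rule framed_maximumI[where s = 7]) (use upper[of _ 2] vals in simp_all)
  show "framed_maximum 3 7 3"
    by (rule framed_maximumI[where s = 8]) (use upper[of _ 3] vals in simp_all)
qed

lemma framed_maximum_exists:
  assumes "n \<ge> 1"
  shows "\<exists>i m. framed_maximum n i m"
  using assms
proof (induction n rule: less_induct)
  case (less n)
  show ?case
  proof (cases "n < 4")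
    case True
    then have "n = 1 \<or> n = 2 \<or> n = 3"
      using less.prems by linarith
    then show ?thesis
      using framed_maximum_small by blast
  next
    case False
    define q where "q = n div 4"
    have n: "n = 4 * q \<or> n = 4 * q + 1 \<or> n = 4 * q + 2 \<or> n = 4 * q + 3" and "q \<ge> 1"
      using False unfolding q_def by presburger+
    then have "q < n" "q + 1 < n"
      by linarith+
    then obtain i m k m' where "framed_maximum q i m" "framed_maximum (q + 1) k m'"
      using less.IH[of q] less.IH[of "q + 1"] \<open>q \<ge> 1\<close> by auto
    then show ?thesis
      using n framed_maximum_4n framed_maximum_4n_plus_1 framed_maximum_4n_plus_2
        framed_maximum_4n_plus_3
      by blast
  qed
qed

theorem theorem1:
  shows "(\<forall>n\<ge>1. max_window_sum rudin_shapiro n = max_window_sum rudin_shapiro_alt n) \<and>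
    M 1 = 1 \<and> M 2 = 2 \<and> M 3 = 3 \<and>
    (\<forall>n\<ge>1.
       M (4 * n) = 2 * M n + 2 \<and>
       M (4 * n + 1) = 2 * M n + 1 \<and>
       M (4 * n + 2) = M n + M (n + 1) + 1 \<and>
       M (4 * n + 3) = 2 * M (n + 1) + 1)"
proof (intro conjI allI impI)
  show "max_window_sum rudin_shapiro n = max_window_sum rudin_shapiro_alt n" for n
    by (simp add: max_window_sum_def window_sums_alt)
  show "M 1 = 1" "M 2 = 2" "M 3 = 3"
    using framed_maximum_small by (auto dest: framed_maximum_imp_M)
next
  fix n :: nat
  assume "n \<ge> 1"
  then obtain i m k m' where short: "framed_maximum n i m" and long: "framed_maximum (n + 1) k m'"
    using framed_maximum_exists[of n] framed_maximum_exists[of "n + 1"] by auto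
  note vals = framed_maximum_imp_M[OF short] framed_maximum_imp_M[OF long]
  show "M (4 * n) = 2 * M n + 2"
    using framed_maximum_imp_M[OF framed_maximum_4n[OF short]] vals by simp
  show "M (4 * n + 1) = 2 * M n + 1"
    using framed_maximum_imp_M[OF framed_maximum_4n_plus_1[OF short]] vals by simp
  show "M (4 * n + 2) = M n + M (n + 1) + 1"
    using framed_maximum_4n_plus_2[OF short long] vals by (auto dest: framed_maximum_imp_M)
  show "M (4 * n + 3) = 2 * M (n + 1) + 1"
    using framed_maximum_imp_M[OF framed_maximum_4n_plus_3[OF long]] vals by simp
qed

end
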